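(* Let $S$ be a cap in $\Sigma=\mathrm{PG}(n,2)$ and let $H_\infty$ be a subspace of codimension $2$ with $S\cap H_\infty=\emptyset$; let $K_A,K_B,K_C$ be the three hyperplanes containing $H_\infty$, $H_X=K_X\setminus H_\infty$, $A=S\cap H_A$, $B=S\cap H_B$, $C=S\cap H_C$ with $C\neq\emptyset$, and use the notation $\widetilde F$, $r$, $F$, $W$, $\widehat C$, $H_A(i)$, $H_B(i)$, $A(i)$, $B(i)$, $A'(i)$, $B'(i)$, $t$, $u$, $\overline{A_f}$, $\overline{B_f}$ from the context. Suppose that $A(i)+C=B'(i)$ and $B(i)+C=A'(i)$ for all $i=1,\dots,2^{n-r-1}$. Suppose $0<t+u<2^{n-r-1}$, that $t\neq u$, that either $\overline{A_f}$ or $\overline{B_f}$ is non-periodic (as a subset of $\overline\Sigma$), and that $\widehat C\setminus C\subseteq\bigcup_{i=1}^{2^{n-r-1}}\bigl(A(i)+B(i)\bigr)$. Then $S$ is a complete cap in $\Sigma$.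
   Context: Points of $\mathrm{PG}(n,2)$ are the nonzero vectors of $\mathbb{F}_2^{n+1}$; three distinct points $x,y,z$ are collinear iff $x+y=z$. A cap is a set with no three collinear points; complete if not properly contained in another cap. For disjoint sets $X,Y$, $X+Y=\{x+y:x\in X,y\in Y\}$. A set $X$ of points of a projective space over $\mathbb{F}_2$ is periodic if some point $v$ satisfies $\{v+x:x\in X\}=X$. Let $\widetilde F$ be the projective subspace spanned by $C$, of projective dimension $r$; $F=\widetilde F\cap H_\infty$ (projective dimension $r-1$), $W=F\cup\{0\}$ (an $r$-dimensional linear subspace of $\mathbb{F}_2^{n+1}$), and $\widehat C=\widetilde F\setminus F$. The set $H_A$ is partitioned into the $2^{n-r-1}$ cosets $H_A(1),\dots,H_A(2^{n-r-1})$, each of the form $a+W=\{a+w:w\in W\}$ with $a\in H_A$; put $H_B(i)=c+H_A(i)$ for any $c\in\widehat C$ (independent of the choice). Let $A(i)=A\cap H_A(i)$, $A'(i)=H_A(i)\setminus A(i)$, $B(i)=B\cap H_B(i)$, $B'(i)=H_B(i)\setminus B(i)$. Let $t$ be the number of $i$ with $H_A(i)\subseteq S$ and $u$ the number of $i$ with $H_A(i)\cap S=\emptyset$. Let $\overline\Sigma\cong\mathrm{PG}(n-r,2)$ be the quotient projective geometry of $\mathbb{F}_2^{n+1}/W$; each coset $H_A(i)$, $H_B(i)$ maps to a single point $\overline{a_i}$, $\overline{b_i}$ of $\overline\Sigma$. Put $\overline{A_f}=\{\overline{a_i}: H_A(i)\subseteq S\}$ and $\overline{B_f}=\{\overline{b_i}:H_B(i)\subseteq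 S\}$. *)

theory Defs
  imports "HOL-Analysis.Analysis" "HOL-Library.Z2" "HOL-Library.Set_Algebras"
begin

text \<open>
  The space \<open>\<bbbF>\<^sub>2\<^sup>n\<^sup>+\<^sup>1\<close> is \<^typ>\<open>bit ^ 'd\<close> with \<open>CARD('d) = n + 1\<close>. Translates \<open>x +o X\<close> and sumsets
  \<open>X + Y\<close> are those of \<^theory>\<open>HOL-Library.Set_Algebras\<close>.
\<close>

definition pg_points :: "(bit ^ 'd) set" where
  "pg_points = UNIV - {0}"

definition pg_collinear :: "bit ^ 'd \<Rightarrow> bit ^ 'd \<Rightarrow> bit ^ 'd \<Rightarrow> bool" where
  "pg_collinear x y z \<longleftrightarrow> x \<noteq> y \<and> y \<noteq> z \<and> x \<noteq> z \<and> x + y = z"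

definition cap :: "(bit ^ 'd) set \<Rightarrow> bool" where
  "cap S \<longleftrightarrow> S \<subseteq> pg_points \<and> \<not> (\<exists>x\<in>S. \<exists>y\<in>S. \<exists>z\<in>S. pg_collinear x y z)"

definition complete_cap :: "(bit ^ 'd) set \<Rightarrow> bool" where
  "complete_cap S \<longleftrightarrow> cap S \<and> \<not> (\<exists>T. cap T \<and> S \<subset> T)"

definition proj_subspace :: "(bit ^ 'd) set \<Rightarrow> bool" where
  "proj_subspace X \<longleftrightarrow> X \<subseteq> pg_points \<and> vec.subspace (X \<union> {0})"

text \<open>Integer-valued, so that the empty projective subspace has dimension \<open>-1\<close>.\<close>

definition proj_dim :: "(bit ^ 'd) set \<Rightarrow> int" where
  "proj_dim X = int (vec.dim (X \<union> {0})) - 1"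

definition proj_span :: "(bit ^ 'd) set \<Rightarrow> (bit ^ 'd) set" where
  "proj_span X = vec.span X - {0}"

definition hyperplane :: "(bit ^ 'd) set \<Rightarrow> bool" where
  "hyperplane K \<longleftrightarrow> proj_subspace K \<and> proj_dim K = int CARD('d) - 2"

definition cosets_in :: "(bit ^ 'd) set \<Rightarrow> (bit ^ 'd) set \<Rightarrow> (bit ^ 'd) set set" where
  "cosets_in H W = {a +o W | a. a \<in> H}"

text \<open>
  The points of the projective geometry of \<open>\<bbbF>\<^sub>2\<^sup>n\<^sup>+\<^sup>1 / W\<close> are the cosets of \<open>W\<close> other than the zero
  coset \<open>W\<close> itself; the sum of two cosets in the quotient space is their sumset. In particular the
  image of a coset \<open>a + W\<close>, \<open>a \<notin> W\<close>, in this geometry is the point \<open>a + W\<close>.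
\<close>

definition quot_points :: "(bit ^ 'd) set \<Rightarrow> (bit ^ 'd) set set" where
  "quot_points W = cosets_in UNIV W - {W}"

text \<open>
  \<open>P\<close> is the point set of the ambient projective space, given by the nonzero elements of a vector
  space over \<open>\<bbbF>\<^sub>2\<close> with addition \<open>+\<close>.
\<close>

definition periodic_in :: "'a::plus set \<Rightarrow> 'a set \<Rightarrow> bool" where
  "periodic_in P X \<longleftrightarrow> (\<exists>v\<in>P. {v + x | x. x \<in> X} = X)"

end

theory Submission
  imports Defs
begin

text \<open>
  A point outside \<open>S\<close> of \<open>H\<^sub>A\<close>, \<open>H\<^sub>B\<close> or \<open>C_hat\<close> is a sum of two points of \<open>S\<close> directly by the
  hypotheses, and so is every point of \<open>F\<close>, because \<open>S\<close> contains some coset of \<open>W\<close>. The equations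
  \<open>A(i) + C = B'(i)\<close>, \<open>B(i) + C = A'(i)\<close> imply that \<open>S\<close> contains \<open>H\<^sub>A(i)\<close> iff it misses \<open>H\<^sub>B(i)\<close>,
  and vice versa. If a point \<open>x\<close> is not a sum of two points of \<open>S\<close>, translation by \<open>x\<close> takes cosets
  contained in \<open>S\<close> to cosets missing \<open>S\<close>. For \<open>x \<in> H\<^sub>\<infinity> - F\<close> it therefore swaps the full and the
  empty cosets in \<open>H\<^sub>A\<close>, so that \<open>t = u\<close>; for \<open>x \<in> H\<^sub>C - C_hat\<close>, translation by \<open>x + c\<close> preserves
  the full cosets both in \<open>H\<^sub>A\<close> and in \<open>H\<^sub>B\<close>, which makes both quotient sets periodic.
\<close>

section \<open>Vectors over the two-element field and cosets\<close>

lemma bit_vec_add_self [simp]: "x + x = (0 :: bit ^ 'd)"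
  by (simp add: vec_eq_iff)

lemma bit_vec_add_self_left [simp]: "x + (x + y) = (y :: bit ^ 'd)"
  by (simp add: add.assoc[symmetric])

text \<open>As rewrite rules these sort the summands and cancel equal pairs, which settles
  identities between sums in characteristic 2.\<close>

lemmas bit_vec_ac = add.assoc add.commute add.left_commute
  bit_vec_add_self bit_vec_add_self_left add_0_left add_0_right

lemma bit_vec_add_eq_iff: "x + y = z \<longleftrightarrow> y = x + (z :: bit ^ 'd)"
  by auto

lemma bit_vec_diff_eq_add: "x - y = x + (y :: bit ^ 'd)"
  by (simp add: diff_eq_eq add.assoc)

lemma mem_coset_iff: "y \<in> x +o W \<longleftrightarrow> x + y \<in> (W :: (bit ^ 'd) set)"
  by (force simp: elt_set_plus_def)

lemma coset_subset_iff: "x +o W \<subseteq> X \<longleftrightarrow> (\<forall>w\<in>W. x + w \<in> X)"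
  by (auto simp: elt_set_plus_def)

lemma coset_disjoint_iff: "(x +o W) \<inter> X = {} \<longleftrightarrow> (\<forall>w\<in>W. x + w \<notin> X)"
  by (auto simp: elt_set_plus_def)

text \<open>Rests on \<open>W + W = W\<close>; this lets the sumset of cosets serve as the addition
  of the quotient space.\<close>

lemma coset_plus_coset:
  assumes "vec.subspace (W :: (bit ^ 'd) set)"
  shows "(x +o W) + (y +o W) = (x + y) +o W"
proof -
  have "W + W = W"
    using assms by (auto simp: set_plus_def vec.subspace_def) (metis add.left_neutral)
  then show ?thesis
    by (simp add: set_plus_rearrange)
qed

text \<open>Translation by \<open>y\<close> is an involution, so once it maps the family into itself
  it maps it onto itself. The conclusion has the shape demanded by
  \<open>periodic_in\<close>.\<close>

lemma translate_full_cosets_eq: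
  fixes W S H :: "(bit ^ 'd) set"
  assumes W: "vec.subspace W"
    and translate: "\<And>a. a \<in> H \<Longrightarrow> a +o W \<subseteq> S \<Longrightarrow> y + a \<in> H \<and> (y + a) +o W \<subseteq> S"
  defines "X \<equiv> {a +o W | a. a \<in> H \<and> a +o W \<subseteq> S}"
  shows "{(y +o W) + x | x. x \<in> X} = X"
proof (intro equalityI subsetI)
  fix z assume "z \<in> {(y +o W) + x | x. x \<in> X}"
  then show "z \<in> X"
    unfolding X_def using translate coset_plus_coset[OF W] by fastforce
next
  fix z assume "z \<in> X"
  then obtain a where a: "a \<in> H" "a +o W \<subseteq> S" "z = a +o W"
    unfolding X_def by blast
  have "(y + a) +o W \<in> X"
    unfolding X_def using translate[OF a(1,2)] by blast
  moreover have "z = (y +o W) + ((y + a) +o W)"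
    using coset_plus_coset[OF W, of y "y + a"] a(3) by simp
  ultimately show "z \<in> {(y +o W) + x | x. x \<in> X}"
    by blast
qed

section \<open>Hyperplanes through a subspace of codimension 2\<close>

lemma span_insert_bit:
  assumes "vec.subspace (U :: (bit ^ 'd) set)"
  shows "vec.span (insert v U) = U \<union> (v +o U)"
proof -
  have "x \<in> vec.span (insert v U) \<longleftrightarrow> x \<in> U \<or> v + x \<in> U" for x
  proof -
    have "vec.span U = U"
      using assms by simp
    then have "x \<in> vec.span (insert v U) \<longleftrightarrow> (\<exists>k. x - k *s v \<in> U)"
      by (metis vec.span_breakdown_eq)
    \<comment> \<open>The only scalars are 0 and 1.\<close>
    also have "\<dots> \<longleftrightarrow> x - 0 *s v \<in> U \<or> x - 1 *s v \<in> U"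
      using bit_not_one_iff by metis
    also have "\<dots> \<longleftrightarrow> x \<in> U \<or> v + x \<in> U"
      unfolding bit_vec_diff_eq_add by (simp add: add.commute[of v])
    finally show ?thesis .
  qed
  then show ?thesis
    by (intro set_eqI) (simp add: mem_coset_iff)
qed

lemma hyperplane_span_insert:
  fixes U :: "(bit ^ 'd) set"
  assumes U: "vec.subspace U" "vec.dim U + 2 = CARD('d)" and "v \<notin> U"
  shows "hyperplane (vec.span (insert v U) - {0})"
proof -
  have "vec.dim (insert v U) = vec.dim U + 1"
    using assms by (simp add: vec.dim_insert vec.span_eq_iff[THEN iffD2])
  moreover have "vec.span (insert v U) - {0} \<union> {0} = vec.span (insert v U)"
    using vec.span_zero by blast
  ultimately show ?thesis
    using U(2) by (auto simp: hyperplane_def proj_subspace_def proj_dim_def pg_points_def)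
qed

text \<open>By a dimension count \<open>K \<union> {0}\<close> is the span of \<open>U\<close> and
  \<open>v\<close>, which over the two-element field consists of just two cosets of
  \<open>U\<close>.\<close>

lemma hyperplane_diff_eq_coset:
  fixes U K :: "(bit ^ 'd) set"
  assumes U: "vec.subspace U" "vec.dim U + 2 = CARD('d)"
    and K: "hyperplane K" "U - {0} \<subseteq> K" and v: "v \<in> K - U"
  shows "K - U = v +o U"
proof -
  have sub: "vec.subspace (K \<union> {0})" and "0 \<notin> K"
    using K(1) by (auto simp: hyperplane_def proj_subspace_def pg_points_def)
  have *: "vec.span (insert v U) \<subseteq> K \<union> {0}"
    using sub K(2) v by (intro vec.span_minimal) auto
  have "vec.dim (insert v U) = vec.dim U + 1"
    using U v by (simp add: vec.dim_insert vec.span_eq_iff[THEN iffD2])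
  then have "vec.dim (K \<union> {0}) \<le> vec.dim (vec.span (insert v U))"
    using K(1) U(2) by (simp add: hyperplane_def proj_dim_def)
  then have "vec.span (insert v U) = K \<union> {0}"
    using * sub by (intro vec.subspace_dim_equal) auto
  then have "K \<union> {0} = U \<union> (v +o U)"
    using span_insert_bit[OF U(1)] by metis
  moreover have "(v +o U) \<inter> U = {}"
  proof -
    have "v \<in> U" if "x \<in> U" "v + x \<in> U" for x
      using vec.subspace_add[OF U(1) that] by (simp add: add.left_commute)
    then show ?thesis
      using v by (auto simp: mem_coset_iff)
  qed
  moreover have "0 \<in> U"
    using U(1) by (rule vec.subspace_0)
  ultimately show ?thesis
    using \<open>0 \<notin> K\<close> by blast
qed

text \<open>A vector outside \<open>U\<close> spans with \<open>U\<close> one of the three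
  hyperplanes, hence the covering. Outside \<open>U\<close> each hyperplane is a single coset of
  \<open>U\<close>, so the sum of points from two of them avoids \<open>U\<close> and both of these,
  and only the third is left. The other pairs follow by permuting the names.\<close>

lemma plane_pencil:
  fixes U :: "(bit ^ 'd) set"
  assumes U: "vec.subspace U" "vec.dim U + 2 = CARD('d)"
    and K: "{K. hyperplane K \<and> U - {0} \<subseteq> K} = {K1, K2, K3}"
    and distinct: "K1 \<noteq> K2" "K2 \<noteq> K3" "K1 \<noteq> K3"
  shows "x \<in> U \<or> x \<in> K1 - U \<or> x \<in> K2 - U \<or> x \<in> K3 - U"
    and "x \<in> K1 - U \<Longrightarrow> y \<in> K2 - U \<Longrightarrow> x + y \<in> K3 - U"
proof -
  have cover: "x \<in> U \<or> x \<in> K1 - U \<or> x \<in> K2 - U \<or> x \<in> K3 - U" for x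
  proof (cases "x \<in> U")
    case False
    define L where "L = vec.span (insert x U) - {0}"
    have "x \<noteq> 0"
      using False vec.subspace_0[OF U(1)] by metis
    then have "x \<in> L" "U - {0} \<subseteq> L"
      by (auto simp: L_def vec.span_base)
    have "hyperplane L"
      unfolding L_def using U False by (rule hyperplane_span_insert)
    with \<open>U - {0} \<subseteq> L\<close> have "L \<in> {K. hyperplane K \<and> U - {0} \<subseteq> K}"
      by simp
    then have "L = K1 \<or> L = K2 \<or> L = K3"
      unfolding K by simp
    with \<open>x \<in> L\<close> False show ?thesis by blast
  qed simp
  then show "x \<in> U \<or> x \<in> K1 - U \<or> x \<in> K2 - U \<or> x \<in> K3 - U" .
  have member: "hyperplane K" "U - {0} \<subseteq> K" if "K \<in> {K1, K2, K3}" for K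
  proof -
    have "K \<in> {K. hyperplane K \<and> U - {0} \<subseteq> K}"
      unfolding K by (fact that)
    then show "hyperplane K" "U - {0} \<subseteq> K" by simp_all
  qed
  have coset: "K - U = v +o U" if "K \<in> {K1, K2, K3}" "v \<in> K - U" for K v
    using hyperplane_diff_eq_coset[OF U member[OF that(1)] that(2)] .
  have closed: "x + y \<in> U \<longleftrightarrow> y \<in> K" if "K \<in> {K1, K2, K3}" "x \<in> K - U" "y \<notin> U" for K x y
    using coset[OF that(1,2)] that(3) by (auto simp: mem_coset_iff set_eq_iff)
  \<comment> \<open>A common point outside \<open>U\<close> generates the same coset of
    \<open>U\<close> in both hyperplanes.\<close>
  have disjoint: "K = L"
    if "K \<in> {K1, K2, K3}" "L \<in> {K1, K2, K3}" "z \<in> K - U" "z \<in> L - U" for K L z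
  proof -
    have "K - U = L - U"
      using coset[OF that(1,3)] coset[OF that(2,4)] by metis
    moreover have "0 \<notin> K" "0 \<notin> L"
      using member(1)[OF that(1)] member(1)[OF that(2)]
      unfolding hyperplane_def proj_subspace_def pg_points_def by blast+
    ultimately show ?thesis
      using member(2)[OF that(1)] member(2)[OF that(2)] by blast
  qed
  show "x + y \<in> K3 - U" if x: "x \<in> K1 - U" and y: "y \<in> K2 - U"
  proof -
    have "x + y \<notin> U"
      using closed[of K1 x y] disjoint[of K1 K2 y] distinct(1) x y by auto
    moreover have "x + y \<notin> K1"
      using closed[of K1 x "x + y"] x y \<open>x + y \<notin> U\<close> by simp
    moreover have "x + y \<notin> K2"
      using closed[of K2 y "x + y"] x y \<open>x + y \<notin> U\<close> by (simp add: add.left_commute)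
    ultimately show ?thesis
      using cover[of "x + y"] by blast
  qed
qed

text \<open>A point added to \<open>S\<close> would be collinear with \<open>p\<close> and
  \<open>q\<close>; these are distinct because their sum is nonzero.\<close>

lemma complete_capI:
  assumes "cap S"
    and "\<And>x. x \<noteq> 0 \<Longrightarrow> x \<notin> S \<Longrightarrow> \<exists>p\<in>S. \<exists>q\<in>S. p + q = x"
  shows "complete_cap S"
  unfolding complete_cap_def
proof (intro conjI notI)
  assume "\<exists>T. cap T \<and> S \<subset> T"
  then obtain T x where T: "cap T" "S \<subseteq> T" "x \<in> T" "x \<notin> S" by blast
  then have "x \<noteq> 0" by (auto simp: cap_def pg_points_def)
  then obtain p q where pq: "p \<in> S" "q \<in> S" "p + q = x"
    using assms(2) T(4) by blast
  then have "pg_collinear p q x"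
    using \<open>x \<noteq> 0\<close> T(4) by (auto simp: pg_collinear_def)
  then show False
    using T pq unfolding cap_def by blast
qed (fact assms(1))

theorem theorem4p1:
  fixes n r t u :: nat
    and S Hinf KA KB KC HA HB HC A B C F_span F W C_hat :: "(bit ^ 'd) set"
    and c :: "bit ^ 'd"
    and I :: "nat set"
    and HAi HBi Ai Ai' Bi Bi' :: "nat \<Rightarrow> (bit ^ 'd) set"
    and Af Bf :: "(bit ^ 'd) set set"
  assumes n: "CARD('d) = n + 1"
    and S_cap: "cap S"
    and Hinf: "proj_subspace Hinf" "proj_dim Hinf = int n - 2"
    and S_Hinf: "S \<inter> Hinf = {}"
    and K: "{K. hyperplane K \<and> Hinf \<subseteq> K} = {KA, KB, KC}" "KA \<noteq> KB" "KB \<noteq> KC" "KA \<noteq> KC"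
    and H_def: "HA = KA - Hinf" "HB = KB - Hinf" "HC = KC - Hinf"
    and ABC_def: "A = S \<inter> HA" "B = S \<inter> HB" "C = S \<inter> HC"
    and C_nonempty: "C \<noteq> {}"
    and F_span_def: "F_span = proj_span C"
    and r: "proj_dim F_span = int r"
    and F_def: "F = F_span \<inter> Hinf"
    and W_def: "W = F \<union> {0}"
    and C_hat_def: "C_hat = F_span - F"
    and I_def: "I = {1..2 ^ (n - r - 1)}"
    and HAi: "bij_betw HAi I (cosets_in HA W)"
    and c: "c \<in> C_hat"
    and HB_def: "\<And>i. HBi i = c +o HAi i"
    and A_def: "\<And>i. Ai i = A \<inter> HAi i"  "\<And>i. Ai' i = HAi i - Ai i"
    and B_def: "\<And>i. Bi i = B \<inter> HBi i"  "\<And>i. Bi' i = HBi i - Bi i"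
    and t_def: "t = card {i \<in> I. HAi i \<subseteq> S}"
    and u_def: "u = card {i \<in> I. HAi i \<inter> S = {}}"
    and Af_def: "Af = {HAi i | i. i \<in> I \<and> HAi i \<subseteq> S}"
    and Bf_def: "Bf = {HBi i | i. i \<in> I \<and> HBi i \<subseteq> S}"
    and AC: "\<And>i. i \<in> I \<Longrightarrow> Ai i + C = Bi' i"
    and BC: "\<And>i. i \<in> I \<Longrightarrow> Bi i + C = Ai' i"
    and tu: "0 < t + u" "t + u < 2 ^ (n - r - 1)" "t \<noteq> u"
    and nonperiodic:
      "\<not> periodic_in (quot_points W) Af \<or> \<not> periodic_in (quot_points W) Bf"
    and covered: "C_hat - C \<subseteq> (\<Union>i\<in>I. Ai i + Bi i)"
  shows "complete_cap S"
proof (rule complete_capI[OF S_cap])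

  \<comment> \<open>The pencil of hyperplanes through \<open>Hinf\<close>\<close>
  define U where "U = Hinf \<union> {0}"
  have Hinf_eq: "Hinf = U - {0}"
    using Hinf(1) by (auto simp: U_def proj_subspace_def pg_points_def)
  have U: "vec.subspace U" "vec.dim U + 2 = CARD('d)"
    using Hinf n by (auto simp: U_def proj_subspace_def proj_dim_def)
  have "0 \<in> U" using U(1) by (rule vec.subspace_0)
  have K0: "0 \<notin> KA" "0 \<notin> KB" "0 \<notin> KC"
    using K(1) by (auto simp: hyperplane_def proj_subspace_def pg_points_def)
  have H: "HA = KA - U" "HB = KB - U" "HC = KC - U"
    using H_def K0 by (auto simp: Hinf_eq)
  note pencil = plane_pencil[OF U, folded Hinf_eq]
  have cover: "x \<in> U \<or> x \<in> HA \<or> x \<in> HB \<or> x \<in> HC" for x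
    unfolding H by (rule pencil(1)[OF K])
  have AB_C: "a + b \<in> HC" if "a \<in> HA" "b \<in> HB" for a b
    using pencil(2)[OF K] that unfolding H by blast
  have "{K. hyperplane K \<and> Hinf \<subseteq> K} = {KA, KC, KB}"
    using K(1) by auto
  then have AC_B: "a + c \<in> HB" if "a \<in> HA" "c \<in> HC" for a c
    using pencil(2)[of KA KC KB] that K(2-4) unfolding H by blast
  have "{K. hyperplane K \<and> Hinf \<subseteq> K} = {KB, KC, KA}"
    using K(1) by auto
  then have BC_A: "b + c \<in> HA" if "b \<in> HB" "c \<in> HC" for b c
    using pencil(2)[of KB KC KA] that K(2-4) unfolding H by blast
  have coset_H: "K - U = v +o U" if "K \<in> {KA, KB, KC}" "v \<in> K - U" for K v
    using hyperplane_diff_eq_coset[OF U _ _ that(2)] that(1) K(1) unfolding Hinf_eq by blast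
  have H_U: "v + w \<in> HA" if "v \<in> HA" "w \<in> U" for v w
    using coset_H[of KA v] that unfolding H by (auto simp: mem_coset_iff)
  have HB_U: "v + w \<in> HB" if "v \<in> HB" "w \<in> U" for v w
    using coset_H[of KB v] that unfolding H by (auto simp: mem_coset_iff)
  have CC_U: "v + w \<in> U" if "v \<in> HC" "w \<in> HC" for v w
    using coset_H[of KC v] that unfolding H by (auto simp: mem_coset_iff)

  \<comment> \<open>The subspace \<open>W\<close> and the span of \<open>C\<close>\<close>
  have W_eq: "W = vec.span C \<inter> U"
    using \<open>0 \<in> U\<close> vec.span_zero[of C]
    by (auto simp: W_def F_def F_span_def proj_span_def Hinf_eq)
  have C_hat_eq: "C_hat = vec.span C - U"
    using \<open>0 \<in> U\<close> by (auto simp: C_hat_def F_def F_span_def proj_span_def Hinf_eq)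
  have W: "vec.subspace W"
    unfolding W_eq by (intro vec.subspace_inter vec.subspace_span U(1))
  have "W \<subseteq> U" unfolding W_eq by simp
  have "0 \<in> W" using W by (rule vec.subspace_0)
  have "C \<subseteq> HC" using ABC_def(3) by simp
  have "vec.subspace (KC \<union> {0})"
    using K(1) by (auto simp: hyperplane_def proj_subspace_def)
  then have "vec.span C \<subseteq> KC \<union> {0}"
    using \<open>C \<subseteq> HC\<close> unfolding H by (intro vec.span_minimal) auto
  then have C_hat_HC: "C_hat \<subseteq> HC"
    using \<open>0 \<in> U\<close> unfolding C_hat_eq H by blast
  have cHC: "c \<in> HC" using c C_hat_HC by blast
  have c_span: "c \<in> vec.span C" using c C_hat_eq by blast
  \<comment> \<open>Used in contrapositive form: it later ensures that a candidate period is nonzero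
    in the quotient.\<close>
  have mem_C_hat: "x \<in> C_hat" if "x \<in> HC" "x + c \<in> W" for x
  proof -
    have "x + c \<in> vec.span C"
      using that(2) unfolding W_eq by simp
    then have "(x + c) + c \<in> vec.span C"
      using c_span by (rule vec.span_add)
    then show ?thesis
      using that(1) unfolding C_hat_eq H by (simp add: add.assoc)
  qed
  \<comment> \<open>All of \<open>C\<close> lies in the one coset \<open>c + W\<close>, so adding
    any point of \<open>C\<close> exchanges \<open>HAi i\<close> and \<open>HBi i\<close>.\<close>
  have C_W: "c + d \<in> W" if "d \<in> C" for d
    using that CC_U[OF cHC, of d] \<open>C \<subseteq> HC\<close> vec.span_add[OF c_span vec.span_base[OF that]]
    unfolding W_eq by blast

  \<comment> \<open>Cosets of \<open>W\<close> in \<open>HA\<close> and \<open>HB\<close>\<close>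
  have S_parts: "x \<in> A \<longleftrightarrow> x \<in> S" if "x \<in> HA" for x
    using that ABC_def by simp
  have S_parts': "x \<in> B \<longleftrightarrow> x \<in> S" if "x \<in> HB" for x
    using that ABC_def by simp
  have index: "\<exists>i\<in>I. HAi i = a +o W" if "a \<in> HA" for a
  proof -
    have "a +o W \<in> HAi ` I"
      using that HAi by (auto simp: bij_betw_def cosets_in_def)
    then show ?thesis by auto
  qed
  have HAi_coset: "\<exists>a\<in>HA. HAi i = a +o W" if "i \<in> I" for i
    using bij_betwE[OF HAi] that by (fastforce simp: cosets_in_def)
  have HBi_coset: "HBi i = (c + a) +o W" if "HAi i = a +o W" for i a
    using that HB_def by (simp add: set_plus_rearrange2)
  have in_HA: "a +o W \<subseteq> HA" if "a \<in> HA" for a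
    using H_U[OF that] \<open>W \<subseteq> U\<close> by (auto simp: coset_subset_iff)
  have in_HB: "b +o W \<subseteq> HB" if "b \<in> HB" for b
    using HB_U[OF that] \<open>W \<subseteq> U\<close> by (auto simp: coset_subset_iff)

  \<comment> \<open>The sumset equations read point by point\<close>
  have A_point: "a \<in> S \<longleftrightarrow> (\<forall>d\<in>C. a + d \<notin> S)" if a: "a \<in> HA" for a
  proof -
    obtain i where i: "i \<in> I" "HAi i = a +o W" using index[OF a] by blast
    have "a \<in> HAi i" using i(2) \<open>0 \<in> W\<close> by (simp add: mem_coset_iff)
    then have "a \<in> S \<longleftrightarrow> a \<notin> Bi i + C"
      using BC[OF i(1)] S_parts[OF a] by (auto simp: A_def)
    also have "\<dots> \<longleftrightarrow> (\<forall>d\<in>C. a + d \<notin> Bi i)"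
      by (auto simp: set_plus_def bit_vec_add_eq_iff) (metis add.commute bit_vec_add_self_left)+
    also have "\<dots> \<longleftrightarrow> (\<forall>d\<in>C. a + d \<notin> S)"
    proof (intro ball_cong refl)
      fix d assume d: "d \<in> C"
      have "a + d \<in> HBi i"
        using C_W[OF d] HBi_coset[OF i(2)] by (simp add: mem_coset_iff ac_simps)
      moreover have "a + d \<in> HB" using AC_B a d \<open>C \<subseteq> HC\<close> by blast
      ultimately show "a + d \<notin> Bi i \<longleftrightarrow> a + d \<notin> S"
        using S_parts' by (simp add: B_def)
    qed
    finally show ?thesis .
  qed
  have B_point: "b \<in> S \<longleftrightarrow> (\<forall>d\<in>C. b + d \<notin> S)" if b: "b \<in> HB" for b
  proof -
    \<comment> \<open>Cosets in \<open>HB\<close> are indexed through their translates by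
      \<open>c\<close> in \<open>HA\<close>.\<close>
    have a: "b + c \<in> HA" using BC_A b cHC by blast
    obtain i where i: "i \<in> I" "HAi i = (b + c) +o W" using index[OF a] by blast
    have "b \<in> HBi i"
      using HBi_coset[OF i(2)] \<open>0 \<in> W\<close> by (simp add: mem_coset_iff ac_simps)
    then have "b \<in> S \<longleftrightarrow> b \<notin> Ai i + C"
      using AC[OF i(1)] S_parts'[OF b] by (auto simp: B_def)
    also have "\<dots> \<longleftrightarrow> (\<forall>d\<in>C. b + d \<notin> Ai i)"
      by (auto simp: set_plus_def bit_vec_add_eq_iff) (metis add.commute bit_vec_add_self_left)+
    also have "\<dots> \<longleftrightarrow> (\<forall>d\<in>C. b + d \<notin> S)"
    proof (intro ball_cong refl)
      fix d assume d: "d \<in> C"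
      have "b + d \<in> HAi i"
        using C_W[OF d] i(2) by (simp add: mem_coset_iff ac_simps)
      moreover have "b + d \<in> HA" using BC_A b d \<open>C \<subseteq> HC\<close> by blast
      ultimately show "b + d \<notin> Ai i \<longleftrightarrow> b + d \<notin> S"
        using S_parts by (simp add: A_def)
    qed
    finally show ?thesis .
  qed

  \<comment> \<open>Full and empty cosets\<close>
  have full_empty: "(c + v) +o W \<inter> S = {} \<longleftrightarrow> v +o W \<subseteq> S" if v: "v \<in> HA \<or> v \<in> HB" for v
  proof -
    have coset: "v + w \<in> HA \<or> v + w \<in> HB" if "w \<in> W" for w
      using H_U HB_U v that \<open>W \<subseteq> U\<close> by blast
    have point: "v + w \<in> S \<longleftrightarrow> (\<forall>d\<in>C. v + w + d \<notin> S)" if "w \<in> W" for w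
      using coset[OF that] A_point B_point by blast
    show ?thesis
    proof
      assume *: "(c + v) +o W \<inter> S = {}"
      have "v + w + d \<notin> S" if "w \<in> W" "d \<in> C" for w d
      proof -
        \<comment> \<open>Since \<open>c\<close> cancels, \<open>v + w + d\<close> is
          \<open>c + v\<close> plus this element of \<open>W\<close>, hence a point of the empty
          coset.\<close>
        have "w + (c + d) \<in> W" using W C_W that by (simp add: vec.subspace_add)
        then have "c + v + (w + (c + d)) \<notin> S"
          using * unfolding coset_disjoint_iff by blast
        then show ?thesis by (simp only: bit_vec_ac not_False_eq_True)
      qed
      then show "v +o W \<subseteq> S" using point by (simp add: coset_subset_iff)
    next
      assume *: "v +o W \<subseteq> S"
      obtain d where d: "d \<in> C" using C_nonempty by blast
      have "c + v + w \<notin> S" if "w \<in> W" for w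
      proof -
        \<comment> \<open>Conversely, \<open>c + v + w\<close> is the point
          \<open>v + (w + (c + d))\<close> of the full coset, shifted by \<open>d\<close>; a single
          \<open>d\<close> from \<open>C\<close> suffices.\<close>
        have "w + (c + d) \<in> W" using W C_W d that by (simp add: vec.subspace_add)
        then have "v + (w + (c + d)) + d \<notin> S"
          using * point[of "w + (c + d)"] d by (metis coset_subset_iff)
        then show ?thesis by (simp only: bit_vec_ac not_False_eq_True)
      qed
      then show "(c + v) +o W \<inter> S = {}" by (simp add: coset_disjoint_iff)
    qed
  qed
  have empty_full: "v +o W \<inter> S = {} \<longleftrightarrow> (c + v) +o W \<subseteq> S" if "v \<in> HA \<or> v \<in> HB" for v
  proof -
    have "c + v \<in> HA \<or> c + v \<in> HB"
      using that AC_B BC_A cHC by (metis add.commute)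
    then show ?thesis using full_empty[of "c + v"] by simp
  qed

  \<comment> \<open>Index-free form of \<open>t\<close>, \<open>u\<close>, \<open>Af\<close> and
    \<open>Bf\<close>\<close>
  define fullA where "fullA = {a +o W | a. a \<in> HA \<and> a +o W \<subseteq> S}"
  define emptyA where "emptyA = {a +o W | a. a \<in> HA \<and> (a +o W) \<inter> S = {}}"
  \<comment> \<open>The predicate \<open>P\<close> is left open so that the full and the empty
    cosets are handled together.\<close>
  have HAi_image: "HAi ` {i \<in> I. P (HAi i)} = {a +o W | a. a \<in> HA \<and> P (a +o W)}" for P
    using index HAi_coset by (auto simp: image_iff) (metis, metis)
  have HAi_card: "card {i \<in> I. P (HAi i)} = card {a +o W | a. a \<in> HA \<and> P (a +o W)}" for P
    unfolding HAi_image[symmetric] using HAi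
    by (intro card_image[symmetric]) (auto simp: bij_betw_def inj_on_def)
  have t: "t = card fullA" unfolding t_def fullA_def by (rule HAi_card)
  have u: "u = card emptyA" unfolding u_def emptyA_def by (rule HAi_card)
  have Af: "Af = fullA"
    unfolding Af_def fullA_def by (subst HAi_image[symmetric]) blast
  have Bf: "Bf = {b +o W | b. b \<in> HB \<and> b +o W \<subseteq> S}"
  proof (intro equalityI subsetI)
    fix X assume "X \<in> Bf"
    then obtain i where i: "i \<in> I" "X = HBi i" "X \<subseteq> S" unfolding Bf_def by blast
    obtain a where a: "a \<in> HA" "HAi i = a +o W" using HAi_coset[OF i(1)] by blast
    then show "X \<in> {b +o W | b. b \<in> HB \<and> b +o W \<subseteq> S}"
      using i HBi_coset[OF a(2)] AC_B[OF a(1) cHC] by (auto simp: add.commute)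
  next
    fix X assume "X \<in> {b +o W | b. b \<in> HB \<and> b +o W \<subseteq> S}"
    then obtain b where b: "b \<in> HB" "X = b +o W" "X \<subseteq> S" by blast
    have "c + b \<in> HA" using BC_A[OF b(1) cHC] by (simp add: add.commute)
    then obtain i where i: "i \<in> I" "HAi i = (c + b) +o W" using index by blast
    then show "X \<in> Bf" unfolding Bf_def using HBi_coset[OF i(2)] b by auto
  qed

  \<comment> \<open>Points outside \<open>S\<close> as sums of two points of
    \<open>S\<close>\<close>
  fix x :: "bit ^ 'd"
  assume "x \<noteq> 0" "x \<notin> S"
  show "\<exists>p\<in>S. \<exists>q\<in>S. p + q = x"
  proof (rule ccontr)
    assume "\<not> (\<exists>p\<in>S. \<exists>q\<in>S. p + q = x)"
    then have no_sum: "p + q \<noteq> x" if "p \<in> S" "q \<in> S" for p q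
      using that by blast
    \<comment> \<open>Otherwise \<open>p\<close> and \<open>x + p\<close> would be two points of
      \<open>S\<close> with sum \<open>x\<close>.\<close>
    then have not_S: "x + p \<notin> S" if "p \<in> S" for p
      using that bit_vec_add_eq_iff by (metis add.commute)
    have translate: "(x + v) +o W \<inter> S = {}" if "v +o W \<subseteq> S" for v
      using that not_S by (auto simp: coset_disjoint_iff coset_subset_iff add.assoc)
    have no_S_C: "x + d \<notin> S" if "d \<in> C" for d
      using not_S[of d] that ABC_def(3) by blast
    \<comment> \<open>A point of \<open>HA\<close> or \<open>HB\<close> outside \<open>S\<close> has
      some \<open>x + d\<close> in \<open>S\<close> with \<open>d\<close> in
      \<open>C\<close>.\<close>
    have "x \<notin> HA" "x \<notin> HB"
      using A_point B_point no_S_C \<open>x \<notin> S\<close> by blast+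
    then consider "x \<in> W" | "x \<in> U" "x \<notin> W" | "x \<in> C_hat" | "x \<in> HC" "x \<notin> C_hat"
      using cover by blast
    then show False
    proof cases
      case 1
      have "fullA \<noteq> {} \<or> emptyA \<noteq> {}"
        using tu(1) t u by (metis add_0 card.empty less_irrefl)
      \<comment> \<open>An empty coset also yields a full one, by adding \<open>c\<close>.
        Translation by \<open>x\<close> in \<open>W\<close> keeps that coset, so both
        \<open>v\<close> and \<open>v + x\<close> lie in \<open>S\<close>.\<close>
      then obtain v where v: "v +o W \<subseteq> S"
        using empty_full unfolding fullA_def emptyA_def by blast
      then have "v \<in> S" "v + x \<in> S"
        using \<open>0 \<in> W\<close> 1 by (auto simp: coset_subset_iff dest: bspec[of _ _ 0])
      then show False using not_S by (simp add: add.commute)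
    next
      case 2
      have HA: "x + a \<in> HA" if "a \<in> HA" for a
        using H_U[OF that 2(1)] by (simp add: add.commute)
      have swap: "a +o W \<subseteq> S \<longleftrightarrow> (x + a) +o W \<inter> S = {}" if a: "a \<in> HA" for a
      proof
        \<comment> \<open>Adding \<open>c\<close> makes the empty coset full, adding
          \<open>x\<close> then leaves \<open>c + a + W\<close> empty, and this makes
          \<open>a + W\<close> full.\<close>
        assume "(x + a) +o W \<inter> S = {}"
        then have "(c + (x + a)) +o W \<subseteq> S"
          using empty_full HA[OF a] by blast
        then have "(x + (c + (x + a))) +o W \<inter> S = {}"
          by (rule translate)
        then show "a +o W \<subseteq> S"
          using full_empty[OF disjI1[OF a]] by (simp only: bit_vec_ac simp_thms)
      qed (rule translate)
      \<comment> \<open>Translation by \<open>x\<close> is thus a bijection between the two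
        families, which forces \<open>t = u\<close>.\<close>
      have "emptyA = (+o) x ` fullA"
      proof (intro equalityI subsetI)
        fix X assume "X \<in> emptyA"
        then obtain a where a: "a \<in> HA" "X = a +o W" "X \<inter> S = {}"
          unfolding emptyA_def by blast
        then have "(x + a) +o W \<in> fullA"
          unfolding fullA_def using swap[of "x + a"] HA by auto
        moreover have "X = x +o ((x + a) +o W)"
          using a(2) by (simp add: set_plus_rearrange2)
        ultimately show "X \<in> (+o) x ` fullA" by blast
      next
        fix X assume "X \<in> (+o) x ` fullA"
        then obtain a where a: "a \<in> HA" "a +o W \<subseteq> S" "X = (x + a) +o W"
          unfolding fullA_def by (auto simp: set_plus_rearrange2)
        then show "X \<in> emptyA"
          unfolding emptyA_def using swap[OF a(1)] HA[OF a(1)] by blast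
      qed
      moreover have "inj_on ((+o) x) fullA"
        by (intro inj_onI) (metis bit_vec_add_self set_plus_rearrange2 set_zero_plus)
      ultimately show False
        using tu(3) t u card_image by metis
    next
      case 3
      have "x \<notin> C" using \<open>x \<notin> S\<close> ABC_def(3) by blast
      then obtain i where "x \<in> Ai i + Bi i" using covered 3 by blast
      then obtain p q where "p \<in> Ai i" "q \<in> Bi i" "p + q = x" by (auto elim: set_plus_elim)
      then show False using no_sum ABC_def A_def B_def by blast
    next
      case 4
      \<comment> \<open>Adding \<open>c\<close> and adding \<open>x\<close> each exchange
        \<open>HA\<close> and \<open>HB\<close>, so adding \<open>y\<close> preserves both; as
        \<open>y\<close> is outside \<open>W\<close>, its coset is a point of the quotient.\<close>
      define y where "y = c + x"
      have "y \<notin> W" "y \<in> U"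
        using mem_C_hat[of x] 4 CC_U[OF cHC 4(1)] by (auto simp: y_def add.commute)
      have point: "y +o W \<in> quot_points W"
      proof -
        have "y \<in> y +o W" using \<open>0 \<in> W\<close> by (simp add: mem_coset_iff)
        then have "y +o W \<noteq> W" using \<open>y \<notin> W\<close> by metis
        then show ?thesis unfolding quot_points_def cosets_in_def by blast
      qed
      \<comment> \<open>Adding \<open>x\<close> turns a full coset into an empty one, and adding
        \<open>c\<close> makes that one full again.\<close>
      have step: "(y + v) +o W \<subseteq> S" if "v \<in> HA \<or> v \<in> HB" "v +o W \<subseteq> S" for v
      proof -
        have "x + v \<in> HA \<or> x + v \<in> HB"
          using that(1) AC_B BC_A 4(1) by (metis add.commute)
        then show ?thesis
          using empty_full[of "x + v"] translate[OF that(2)] by (simp add: y_def add.assoc)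
      qed
      \<comment> \<open>The same point is a period of both \<open>Af\<close> and \<open>Bf\<close>,
        contradicting either alternative of \<open>nonperiodic\<close>.\<close>
      have "{(y +o W) + X | X. X \<in> Af} = Af"
        unfolding Af fullA_def using step H_U[OF _ \<open>y \<in> U\<close>]
        by (intro translate_full_cosets_eq[OF W]) (metis add.commute)
      moreover have "{(y +o W) + X | X. X \<in> Bf} = Bf"
        unfolding Bf using step HB_U[OF _ \<open>y \<in> U\<close>]
        by (intro translate_full_cosets_eq[OF W]) (metis add.commute)
      ultimately show False
        using nonperiodic point unfolding periodic_in_def by blast
    qed
  qed
qed

end
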